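(* Let $X=(X_1,\dots,X_d)$ be a random vector in $\mathbb{R}^d$ with independent coordinates and let $f:\mathbb{R}^d\to\mathbb{R}$ be such that $f(X)\in L^2$ and $\mathrm{Var}(f(X))>0$. Let $i\in\{1,\dots,d\}$, assume that the distribution $\mu_i$ of $X_i$ belongs to $\mathcal{P}(a_i,b_i)$, let $w_i\in\mathcal{W}(a_i,b_i)$, and suppose that $\mu_i$ satisfies the weighted Poincaré inequality $$\mathbb{E}\left[g(X_i)^2\right]\le C_P(\mu_i,w_i)\,\mathbb{E}\left[w_i(X_i)\,g'(X_i)^2\right]\qquad (\ast)$$ for all centered functions $g\in H^1(\mu_i,w_i)$. Assume also that $(w_i(X_i))^{1/2}\frac{\partial f}{\partial x_i}(X)\in L^2$. Suppose that $f$ has the form $f(x)=u_i(x_{-i})+h_i(x_i)\,v_i(x_{-i})$, where $u_i,v_i$ are functions depending only on $x_{-i}$ with $u_i(X_{-i}),v_i(X_{-i})\in L^2$, and $h_i\in H^1(\mu_i,w_i)$ is centered with respect to $\mu_i$. Assume further that there exists $\varepsilon\ge0$ such that $$\mathbb{E}\left[w_i(X_i)\left(h_i'(X_i)-g_i'(X_i)\right)^2\right]\le\varepsilon,$$ where $g_i$ is a function saturating $(\ast)$. Then $$0\le C_P(\mu_i,w_i)\,\frac{\nu_{i,w_i}}{\mathrm{Var}(f(X))}-S_i^{\mathrm{tot}}\le C_P(\mu_i,w_i)\,\frac{\mathbb{E}\left[v_i(X_{-i})^2\right]}{\mathrm{Var}(f(X))}\,\varepsilon.$$ In particular, if $f$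 has the form $f(x)=u_i(x_{-i})+g_i(x_i)\,v_i(x_{-i})$, then $$S_i^{\mathrm{tot}}= C_P(\mu_i,w_i)\,\frac{\nu_{i,w_i}}{\mathrm{Var}(f(X))}.$$
   Context: For $-\infty\le a<b\le\infty$, $[a,b]$ denotes the interval with infinite endpoints excluded. $\mathscr{C}^{0,1}_+(a,b)$: the set of functions that are continuous and piecewise $\mathscr{C}^1$ on $[a,b]$ and positive on $(a,b)$. $\mathcal{P}(a,b)$: the set of probability measures on $[a,b]$ having a Lebesgue density $\rho\in\mathscr{C}^{0,1}_+(a,b)$ with $\rho(a)>0$ if $a$ is finite and $\rho(b)>0$ if $b$ is finite. $\mathcal{W}(a,b)$ (weights): the set of continuous functions on $[a,b]$ that are piecewise $\mathscr{C}^1$ and positive on $(a,b)$. $H^1(\mu,w)=\{g\in L^2(\mu): w^{1/2}g'\in L^2(\mu)\}$, with $g'$ the weak derivative; $g$ is centered (with respect to $\mu$) if $\int g\,d\mu=0$. The Poincaré constant $C_P(\mu,w)$ is the smallest (finite) constant $C$ such that $\int g^2\,d\mu\le C\int w\,(g')^2\,d\mu$ for all centered $g\in H^1(\mu,w)$. A function saturating this inequality is a non-null centered $g\in H^1(\mu,w)$ realizing equality with $C=C_P(\mu,w)$. For $x\in\mathbb{R}^d$, $x_{-i}$ is the vector of all coordinates $x_j$, $j\neq i$; similarly $X_{-i}$. The total effect of $X_i$ is $f_i^{\mathrm{tot}}(X)=f(X)-\mathbb{E}[f(X)\mid X_{-i}]$. The total Sobol index is $S_i^{\mathrm{tot}}=\mathrm{Var}(f_i^{\mathrm{tot}}(X))/\mathrm{Var}(f(X))$.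 The weighted DGSM index is $\nu_{i,w_i}=\mathbb{E}\left[w_i(X_i)\left(\frac{\partial f}{\partial x_i}(X)\right)^2\right]$. The partial derivative $\partial f/\partial x_i$ is understood as the weak derivative in the variable $x_i$ on $(a_i,b_i)$ for almost every $x_{-i}$. *)

theory Defs
  imports "HOL-Probability.Probability"
begin

section \<open>Intervals, densities and weights\<close>

text \<open>The interval from \<open>a\<close> to \<open>b\<close> with its infinite endpoints excluded. The corresponding
  open interval is \<^const>\<open>einterval\<close>.\<close>

definition closed_einterval :: "ereal \<Rightarrow> ereal \<Rightarrow> real set" where
  "closed_einterval a b = {x. a \<le> ereal x \<and> ereal x \<le> b}"

text \<open>The relation \<^const>\<open>piecewise_C1_differentiable_on\<close> includes continuity on the whole interval.
  Its finite exceptional set may contain the finite endpoints, so nothing is asked of the functions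
  outside the closed interval.\<close>

definition C01_plus :: "ereal \<Rightarrow> ereal \<Rightarrow> (real \<Rightarrow> real) set" where
  "C01_plus a b = {\<rho>. \<rho> piecewise_C1_differentiable_on (closed_einterval a b) \<and>
                       (\<forall>x\<in>einterval a b. \<rho> x > 0)}"

definition measures_P :: "ereal \<Rightarrow> ereal \<Rightarrow> real measure set" where
  "measures_P a b = {\<mu>. prob_space \<mu> \<and>
     (\<exists>\<rho>\<in>C01_plus a b.
        (\<forall>x. a = ereal x \<longrightarrow> \<rho> x > 0) \<and> (\<forall>x. b = ereal x \<longrightarrow> \<rho> x > 0) \<and>
        \<mu> = density lborel (\<lambda>x. ennreal (indicator (closed_einterval a b) x * \<rho> x)))}"

text \<open>A weight is a function on the closed interval, represented by an extension to the real line
  whose values outside the interval are irrelevant. The extension is required to be Borel so that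
  expressions such as \<open>w (X\<^sub>i)\<close> are random variables (extension by zero is Borel).\<close>

definition weights :: "ereal \<Rightarrow> ereal \<Rightarrow> (real \<Rightarrow> real) set" where
  "weights a b = {w \<in> C01_plus a b. w \<in> borel_measurable borel}"

section \<open>Weak derivatives, the weighted Sobolev space and the Poincare constant\<close>

definition L2 :: "'a measure \<Rightarrow> ('a \<Rightarrow> real) set" where
  "L2 M = {Y \<in> borel_measurable M. integrable M (\<lambda>x. (Y x)\<^sup>2)}"

definition test_functions :: "ereal \<Rightarrow> ereal \<Rightarrow> (real \<Rightarrow> real) set" where
  "test_functions a b = {\<phi>. (\<forall>n. (deriv ^^ n) \<phi> differentiable_on UNIV) \<and>
     (\<exists>K. compact K \<and> K \<subseteq> einterval a b \<and> (\<forall>x. x \<notin> K \<longrightarrow> \<phi> x = 0))}"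

definition locally_integrable :: "ereal \<Rightarrow> ereal \<Rightarrow> (real \<Rightarrow> real) \<Rightarrow> bool" where
  "locally_integrable a b g \<longleftrightarrow>
     (\<forall>K. compact K \<and> K \<subseteq> einterval a b \<longrightarrow> set_integrable lborel K g)"

text \<open>Only the values of \<open>g'\<close> in the open interval matter; global Borel measurability selects
  a representative that can be integrated against measures on the real line.\<close>

definition has_weak_deriv :: "ereal \<Rightarrow> ereal \<Rightarrow> (real \<Rightarrow> real) \<Rightarrow> (real \<Rightarrow> real) \<Rightarrow> bool" where
  "has_weak_deriv a b g g' \<longleftrightarrow>
     g' \<in> borel_measurable borel \<and> locally_integrable a b g \<and> locally_integrable a b g' \<and>
     (\<forall>\<phi>\<in>test_functions a b.
        (LINT x:einterval a b|lborel. g x * deriv \<phi> x) =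
        - (LINT x:einterval a b|lborel. g' x * \<phi> x))"

text \<open>Weak derivatives are unique up to Lebesgue null sets of the open interval, so the choice is
  immaterial in integrals against measures with a density concentrated on that interval.\<close>

definition weak_deriv :: "ereal \<Rightarrow> ereal \<Rightarrow> (real \<Rightarrow> real) \<Rightarrow> real \<Rightarrow> real" where
  "weak_deriv a b g = (SOME g'. has_weak_deriv a b g g')"

definition H1 :: "ereal \<Rightarrow> ereal \<Rightarrow> real measure \<Rightarrow> (real \<Rightarrow> real) \<Rightarrow> (real \<Rightarrow> real) set" where
  "H1 a b \<mu> w = {g \<in> L2 \<mu>. (\<exists>g'. has_weak_deriv a b g g') \<and>
                            (\<lambda>x. sqrt (w x) * weak_deriv a b g x) \<in> L2 \<mu>}"

definition centered :: "real measure \<Rightarrow> (real \<Rightarrow> real) \<Rightarrow> bool" where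
  "centered \<mu> g \<longleftrightarrow> (\<integral>x. g x \<partial>\<mu>) = 0"

definition poincare_inequality ::
    "ereal \<Rightarrow> ereal \<Rightarrow> real measure \<Rightarrow> (real \<Rightarrow> real) \<Rightarrow> real \<Rightarrow> bool" where
  "poincare_inequality a b \<mu> w C \<longleftrightarrow>
     (\<forall>g\<in>H1 a b \<mu> w. centered \<mu> g \<longrightarrow>
        (\<integral>x. (g x)\<^sup>2 \<partial>\<mu>) \<le> C * (\<integral>x. w x * (weak_deriv a b g x)\<^sup>2 \<partial>\<mu>))"

text \<open>Unspecified unless some finite constant is admissible; in particular
  \<open>poincare_inequality a b \<mu> w (poincare_constant a b \<mu> w)\<close> is a genuine assumption.\<close>

definition poincare_constant :: "ereal \<Rightarrow> ereal \<Rightarrow> real measure \<Rightarrow> (real \<Rightarrow> real) \<Rightarrow> real" where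
  "poincare_constant a b \<mu> w = (LEAST C. poincare_inequality a b \<mu> w C)"

definition saturates_poincare ::
    "ereal \<Rightarrow> ereal \<Rightarrow> real measure \<Rightarrow> (real \<Rightarrow> real) \<Rightarrow> (real \<Rightarrow> real) \<Rightarrow> bool" where
  "saturates_poincare a b \<mu> w g \<longleftrightarrow>
     g \<in> H1 a b \<mu> w \<and> centered \<mu> g \<and> \<not> (AE x in \<mu>. g x = 0) \<and>
     (\<integral>x. (g x)\<^sup>2 \<partial>\<mu>) =
       poincare_constant a b \<mu> w * (\<integral>x. w x * (weak_deriv a b g x)\<^sup>2 \<partial>\<mu>)"

section \<open>Sensitivity indices\<close>

text \<open>\<open>omit i x\<close> is the vector \<open>x\<^sub>-\<^sub>i\<close> of all coordinates of \<open>x\<close> except the \<open>i\<close>-th one, as an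
  element of the product over the index set \<open>- {i}\<close>; \<open>insert_coord i z t\<close> is the vector with
  \<open>i\<close>-th coordinate \<open>t\<close> and remaining coordinates \<open>z\<close>.\<close>

definition omit :: "'n::finite \<Rightarrow> real ^ 'n \<Rightarrow> 'n \<Rightarrow> real" where
  "omit i x = (\<lambda>j\<in>-{i}. x $ j)"

definition omit_space :: "'n::finite \<Rightarrow> ('n \<Rightarrow> real) measure" where
  "omit_space i = (\<Pi>\<^sub>M j\<in>-{i}. borel)"

definition insert_coord :: "'n::finite \<Rightarrow> ('n \<Rightarrow> real) \<Rightarrow> real \<Rightarrow> real ^ 'n" where
  "insert_coord i z t = (\<chi> j. if j = i then t else z j)"

text \<open>\<open>D\<close> is a (jointly measurable) version of the partial derivative of \<open>f\<close> with respect to the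
  \<open>i\<close>-th variable: for almost every \<open>x\<^sub>-\<^sub>i\<close>, with respect to the law of \<open>X\<^sub>-\<^sub>i\<close>, it is a weak
  derivative in the \<open>i\<close>-th variable.\<close>

definition is_weak_partial ::
    "'a measure \<Rightarrow> ('a \<Rightarrow> real ^ 'n::finite) \<Rightarrow> 'n \<Rightarrow> ereal \<Rightarrow> ereal \<Rightarrow>
       (real ^ 'n \<Rightarrow> real) \<Rightarrow> (real ^ 'n \<Rightarrow> real) \<Rightarrow> bool" where
  "is_weak_partial M X i a b f D \<longleftrightarrow>
     D \<in> borel_measurable borel \<and>
     (AE z in distr M (omit_space i) (\<lambda>\<omega>. omit i (X \<omega>)).
        has_weak_deriv a b (\<lambda>t. f (insert_coord i z t)) (\<lambda>t. D (insert_coord i z t)))"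

definition total_effect ::
    "'a measure \<Rightarrow> ('a \<Rightarrow> real ^ 'n::finite) \<Rightarrow> 'n \<Rightarrow> (real ^ 'n \<Rightarrow> real) \<Rightarrow> 'a \<Rightarrow> real" where
  "total_effect M X i f = (\<lambda>\<omega>. f (X \<omega>) -
     real_cond_exp M (vimage_algebra (space M) (\<lambda>\<omega>. omit i (X \<omega>)) (omit_space i))
       (\<lambda>\<omega>. f (X \<omega>)) \<omega>)"

definition total_sobol ::
    "'a measure \<Rightarrow> ('a \<Rightarrow> real ^ 'n::finite) \<Rightarrow> 'n \<Rightarrow> (real ^ 'n \<Rightarrow> real) \<Rightarrow> real" where
  "total_sobol M X i f =
     prob_space.variance M (total_effect M X i f) / prob_space.variance M (\<lambda>\<omega>. f (X \<omega>))"

text \<open>The weighted DGSM index, as a function of (a version of) the partial derivative.\<close>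

definition weighted_dgsm ::
    "'a measure \<Rightarrow> ('a \<Rightarrow> real ^ 'n::finite) \<Rightarrow> 'n \<Rightarrow> (real \<Rightarrow> real) \<Rightarrow> (real ^ 'n \<Rightarrow> real) \<Rightarrow> real" where
  "weighted_dgsm M X i w D = (\<integral>\<omega>. w (X \<omega> $ i) * (D (X \<omega>))\<^sup>2 \<partial>M)"

end

theory Submission
  imports Defs
begin

text \<open>
  The Poincare deficit \<open>Q h = C * E(w h'\<^sup>2) - E(h\<^sup>2)\<close> is a nonnegative quadratic form on the centered
  part of the weighted Sobolev space and vanishes at the saturating function \<open>g\<close>. Hence
  \<open>Q (h + s g) \<ge> 0\<close> is affine in \<open>s\<close>, so the cross term vanishes as well and
  \<open>Q h = Q (h - g) \<le> C * E(w (h' - g')\<^sup>2)\<close>. For \<open>f = u + h v\<close> with \<open>h\<close> centered, the total effect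
  is \<open>h v\<close> by independence, the partial derivative is \<open>h' v\<close> by uniqueness of weak derivatives,
  and the second moments of both factor, so the quantity to be bounded is \<open>Q h * E(v\<^sup>2) / Var f\<close>.
\<close>

section \<open>Smooth bump functions and the fundamental lemma of the calculus of variations\<close>

text \<open>Both \<open>weak_deriv\<close> (a choice) and \<open>D\<close> (an arbitrary version)
  are determined only up to null sets, so every identity between derivatives has to pass through
  uniqueness. Uniqueness rests on the fundamental lemma of the calculus of variations, which needs
  concrete smooth functions of compact support: products of two rescaled copies of exp(-1/x),
  extended by zero. The resulting Lebesgue null sets are then moved twice, to \<open>\<mu>\<close>
  through its density and to \<open>M\<close> through the product law of the omitted coordinates and
  the \<open>i\<close>-th one. Energies are rewritten with the square root of the weight, because
  this makes them squared L2 norms. Finally, a least constant has no sign by definition; that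
  \<open>C\<close> is nonnegative comes from the saturating function being non-null.\<close>

definition flat :: "nat \<Rightarrow> real \<Rightarrow> real" where
  "flat k x = (if x \<le> 0 then 0 else exp (- inverse x) * inverse x ^ k)"

text \<open>With y = 1/x the right-hand limit is that of y^k / exp y at infinity: the exponential
  beats every power.\<close>

lemma flat_tendsto_0: "(flat k \<longlongrightarrow> 0) (at 0)"
proof (rule filterlim_split_at)
  have "\<forall>\<^sub>F x in at_left 0. flat k x = 0"
    by (auto simp: flat_def eventually_at_left_field intro: exI[of _ "-1"])
  then show "(flat k \<longlongrightarrow> 0) (at_left 0)"
    by (rule tendsto_eventually)
  have "((\<lambda>x::real. inverse x ^ k / exp (inverse x)) \<longlongrightarrow> 0) (at_right 0)"
    by (rule filterlim_compose[OF tendsto_power_div_exp_0 filterlim_inverse_at_top_right])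
  moreover have "\<forall>\<^sub>F x in at_right 0. inverse x ^ k / exp (inverse x) = flat k x"
    by (auto simp: flat_def eventually_at_right_field exp_minus field_simps intro: exI[of _ 1])
  ultimately show "(flat k \<longlongrightarrow> 0) (at_right 0)"
    by (rule Lim_transform_eventually)
qed

lemma flat_has_derivative:
  "(flat k has_real_derivative flat (k + 2) x - real k * flat (k + 1) x) (at x)"
proof -
  consider "x < 0" | "x = 0" | "x > 0" by linarith
  then show ?thesis
  proof cases
    case 1
    have "((\<lambda>_. 0) has_real_derivative 0) (at x)" by simp
    then have "(flat k has_real_derivative 0) (at x)"
      by (rule has_field_derivative_transform_within_open[where S="{..<0}"]) (use 1 in \<open>auto simp: flat_def\<close>)
    then show ?thesis using 1 by (simp add: flat_def)
  next
    case 2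
    \<comment> \<open>At the junction point the difference quotient is again a member of the family,
      so its limit is already known.\<close>
    have "(\<lambda>h. (flat k (0 + h) - flat k 0) / h) = flat (k + 1)"
      by (auto simp: flat_def field_simps)
    then have "(flat k has_real_derivative 0) (at 0)"
      unfolding DERIV_def by (simp only: flat_tendsto_0)
    then show ?thesis using 2 by (simp add: flat_def)
  next
    case 3
    have "((\<lambda>x. exp (- inverse x) * inverse x ^ k) has_real_derivative
        exp (- inverse x) * (inverse x)\<^sup>2 * inverse x ^ k
        + exp (- inverse x) * (real k * inverse x ^ (k - 1) * - (inverse x)\<^sup>2)) (at x)"
      using 3 by (auto intro!: derivative_eq_intros simp: power2_eq_square)
    then have "(flat k has_real_derivative
        exp (- inverse x) * (inverse x)\<^sup>2 * inverse x ^ k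
        + exp (- inverse x) * (real k * inverse x ^ (k - 1) * - (inverse x)\<^sup>2)) (at x)"
      by (rule has_field_derivative_transform_within_open[where S="{0<..}"]) (use 3 in \<open>auto simp: flat_def\<close>)
    moreover have "exp (- inverse x) * (inverse x)\<^sup>2 * inverse x ^ k
        + exp (- inverse x) * (real k * inverse x ^ (k - 1) * - (inverse x)\<^sup>2)
        = flat (k + 2) x - real k * flat (k + 1) x"
      \<comment> \<open>For \<open>k = 0\<close> the exponent \<open>k - 1\<close> is truncated to
        0, which is harmless because of the factor \<open>real k\<close>.\<close>
      using 3 by (cases k) (auto simp: flat_def power2_eq_square algebra_simps)
    ultimately show ?thesis by simp
  qed
qed

text \<open>Smoothness of the bump functions is obtained from a family closed under differentiation.\<close>

inductive_set flat_span :: "real \<Rightarrow> real \<Rightarrow> real \<Rightarrow> (real \<Rightarrow> real) set" for c d r where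
  flat_span_base: "(\<lambda>x. flat j (r * (x - c)) * flat k (r * (d - x))) \<in> flat_span c d r"
| flat_span_lincomb: "f \<in> flat_span c d r \<Longrightarrow> g \<in> flat_span c d r \<Longrightarrow> (\<lambda>x. s * f x + t * g x) \<in> flat_span c d r"

lemma flat_span_has_derivative:
  "f \<in> flat_span c d r \<Longrightarrow> \<exists>f'\<in>flat_span c d r. \<forall>x. (f has_real_derivative f' x) (at x)"
proof (induction rule: flat_span.induct)
  case (flat_span_base j k)
  define B where "B j k x = flat j (r * (x - c)) * flat k (r * (d - x))" for j k x
  \<comment> \<open>This is the product rule, grouped as nested linear combinations so that
    \<open>flat_span_lincomb\<close> applies; the inner derivative \<open>- r\<close> of the second
    factor flips its signs.\<close>
  define f' where "f' x = 1 * (r * B (j + 2) k x + (- real j * r) * B (j + 1) k x)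
      + 1 * ((- r) * B j (k + 2) x + (real k * r) * B j (k + 1) x)" for x
  have B: "B j k \<in> flat_span c d r" for j k
    unfolding B_def[abs_def] by (rule flat_span.flat_span_base)
  have "f' \<in> flat_span c d r"
    unfolding f'_def[abs_def] by (intro flat_span_lincomb B)
  moreover have "((\<lambda>x. flat j (r * (x - c)) * flat k (r * (d - x))) has_real_derivative f' x) (at x)" for x
    by (auto intro!: derivative_eq_intros DERIV_chain'[OF _ flat_has_derivative]
        simp: f'_def B_def algebra_simps)
  ultimately show ?case by blast
next
  case (flat_span_lincomb f g s t)
  then obtain f' g' where "f' \<in> flat_span c d r" "g' \<in> flat_span c d r"
    and d: "\<And>x. (f has_real_derivative f' x) (at x)" "\<And>x. (g has_real_derivative g' x) (at x)"
    by blast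
  moreover have "((\<lambda>x. s * f x + t * g x) has_real_derivative s * f' x + t * g' x) (at x)" for x
    by (auto intro!: derivative_eq_intros d)
  ultimately show ?case
    by (intro bexI[of _ "\<lambda>x. s * f' x + t * g' x"] allI flat_span.flat_span_lincomb)
qed

lemma flat_span_higher_deriv: "f \<in> flat_span c d r \<Longrightarrow> (deriv ^^ n) f \<in> flat_span c d r"
proof (induction n)
  case (Suc n)
  then obtain f' where f': "f' \<in> flat_span c d r"
    "\<And>x. ((deriv ^^ n) f has_real_derivative f' x) (at x)"
    using flat_span_has_derivative by blast
  then have "deriv ((deriv ^^ n) f) = f'" by (auto intro: DERIV_imp_deriv)
  with f' show ?case by simp
qed simp

text \<open>The scaling by \<open>Suc n\<close> steepens both flanks while the support stays inside
  the interval from \<open>c\<close> to \<open>d\<close>, so the sequence approximates an indicator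
  from within.\<close>

definition bump :: "real \<Rightarrow> real \<Rightarrow> nat \<Rightarrow> real \<Rightarrow> real" where
  "bump c d n x = flat 0 (real (Suc n) * (x - c)) * flat 0 (real (Suc n) * (d - x))"

lemma bump_test_function:
  assumes "{c..d} \<subseteq> einterval a b"
  shows "bump c d n \<in> test_functions a b"
proof -
  have "bump c d n \<in> flat_span c d (real (Suc n))"
    unfolding bump_def[abs_def] by (rule flat_span_base)
  then have "(deriv ^^ m) (bump c d n) differentiable_on UNIV" for m
    using flat_span_has_derivative[OF flat_span_higher_deriv]
    by (meson differentiable_at_imp_differentiable_on real_differentiable_def)
  moreover have "x \<notin> {c..d} \<Longrightarrow> bump c d n x = 0" for x
    by (auto simp: bump_def flat_def zero_le_mult_iff mult_le_0_iff)
  ultimately show ?thesis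
    unfolding test_functions_def using assms by blast
qed

lemma bump_bounds: "0 \<le> bump c d n x" "bump c d n x \<le> 1"
proof -
  have "0 \<le> flat 0 y" "flat 0 y \<le> 1" for y
    by (auto simp: flat_def)
  then show "0 \<le> bump c d n x" "bump c d n x \<le> 1"
    unfolding bump_def by (auto intro: mult_le_one)
qed

lemma bump_tendsto: "(\<lambda>n. bump c d n x) \<longlonglongrightarrow> indicator {c<..<d} x"
proof (cases "x \<in> {c<..<d}")
  case True
  have *: "(\<lambda>n. exp (- inverse (real (Suc n) * t))) \<longlonglongrightarrow> 1" if "t > 0" for t
  proof -
    have "(\<lambda>n. exp (- (inverse (real (Suc n)) * inverse t))) \<longlonglongrightarrow> exp (- (0 * inverse t))"
      by (intro tendsto_intros LIMSEQ_inverse_real_of_nat)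
    then show ?thesis by simp
  qed
  have "(\<lambda>n. exp (- inverse (real (Suc n) * (x - c))) * exp (- inverse (real (Suc n) * (d - x))))
      \<longlonglongrightarrow> 1 * 1"
    using True by (intro tendsto_mult *) auto
  moreover have "bump c d n x = exp (- inverse (real (Suc n) * (x - c))) * exp (- inverse (real (Suc n) * (d - x)))" for n
    using True by (auto simp: bump_def flat_def mult_le_0_iff)
  ultimately show ?thesis using True by simp
next
  case False
  then have "bump c d n x = 0" for n
    by (auto simp: bump_def flat_def mult_le_0_iff)
  then show ?thesis using False by simp
qed

lemma bump_measurable[measurable]: "bump c d n \<in> borel_measurable borel"
  unfolding bump_def[abs_def] flat_def by measurable

text \<open>The positive and negative parts of \<open>q\<close> are densities of two finite measures
  that agree on all half-lines and hence coincide. Then \<open>q\<close> integrates to zero over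
  every measurable set, which forces it to vanish almost everywhere.\<close>

lemma integrable_AE_zeroI:
  fixes q :: "real \<Rightarrow> real"
  assumes q: "integrable lborel q" and 0: "\<And>x. (LINT t:{x<..}|lborel. q t) = 0"
  shows "AE x in lborel. q x = 0"
proof -
  \<comment> \<open>\<open>ennreal\<close> maps negative reals to 0, so these densities are exactly
    the positive and the negative part.\<close>
  define P where "P = density lborel (\<lambda>x. ennreal (q x))"
  define N where "N = density lborel (\<lambda>x. ennreal (- q x))"
  have m[measurable]: "q \<in> borel_measurable borel" using q by auto
  have fin: "(\<integral>\<^sup>+x. ennreal (s * q x) * indicator A x \<partial>lborel) = ennreal (\<integral>x. max 0 (s * q x) * indicator A x \<partial>lborel)"
    and int: "integrable lborel (\<lambda>x. max 0 (s * q x) * indicator A x)"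
    if [measurable]: "A \<in> sets borel" for A s
  proof -
    show i: "integrable lborel (\<lambda>x. max 0 (s * q x) * indicator A x)"
      by (rule Bochner_Integration.integrable_bound[OF integrable_mult_right[OF q, of s]]) (auto simp: indicator_def)
    have "(\<integral>\<^sup>+x. ennreal (s * q x) * indicator A x \<partial>lborel) = (\<integral>\<^sup>+x. ennreal (max 0 (s * q x) * indicator A x) \<partial>lborel)"
      by (intro nn_integral_cong) (auto simp: indicator_def max_def ennreal_neg)
    also have "\<dots> = ennreal (\<integral>x. max 0 (s * q x) * indicator A x \<partial>lborel)"
      by (rule nn_integral_eq_integral[OF i]) auto
    finally show "(\<integral>\<^sup>+x. ennreal (s * q x) * indicator A x \<partial>lborel) = ennreal (\<integral>x. max 0 (s * q x) * indicator A x \<partial>lborel)" .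
  qed
  have emP: "emeasure P A = ennreal (\<integral>x. max 0 (1 * q x) * indicator A x \<partial>lborel)" if "A \<in> sets borel" for A
    unfolding P_def using that fin[of A 1] by (simp add: emeasure_density)
  have emN: "emeasure N A = ennreal (\<integral>x. max 0 (-1 * q x) * indicator A x \<partial>lborel)" if "A \<in> sets borel" for A
    unfolding N_def using that fin[of A "-1"] by (simp add: emeasure_density)
  have diff: "(LINT t:A|lborel. q t) = (\<integral>x. max 0 (1 * q x) * indicator A x \<partial>lborel) - (\<integral>x. max 0 (-1 * q x) * indicator A x \<partial>lborel)"
    if "A \<in> sets borel" for A
    unfolding set_lebesgue_integral_def
    by (subst Bochner_Integration.integral_diff[OF int[OF that] int[OF that], symmetric])
      (intro Bochner_Integration.integral_cong, auto simp: max_def indicator_def)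
  have "P = N"
  proof (rule measure_eqI_lessThan)
    fix x
    show "emeasure P {x<..} < \<infinity>" by (subst emP) auto
    have "(\<integral>t. max 0 (1 * q t) * indicator {x<..} t \<partial>lborel) = (\<integral>t. max 0 (-1 * q t) * indicator {x<..} t \<partial>lborel)"
      using 0[of x] diff[of "{x<..}"] by simp
    then show "emeasure P {x<..} = emeasure N {x<..}"
      by (simp add: emP emN)
  qed (auto simp: P_def N_def)
  then have "(LINT t:A|lborel. q t) = 0" if "A \<in> sets lborel" for A
  proof -
    have nn: "0 \<le> (\<integral>x. max 0 (s * q x) * indicator A x \<partial>lborel)" for s
      by (intro integral_nonneg_AE) auto
    show ?thesis
      using emP[of A] emN[of A] diff[of A] that \<open>P = N\<close> ennreal_inj[OF nn nn] by simp
  qed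
  then show ?thesis
    using sigma_finite_measure.density_zero[OF lborel.sigma_finite_measure_axioms q] by blast
qed

text \<open>Bumps converging to the indicator of an open interval turn the test condition into
  vanishing integrals over intervals, to which \<open>integrable_AE_zeroI\<close> applies after
  cutting \<open>q\<close> off.\<close>

lemma fundamental_lemma_calculus_of_variations:
  assumes q[measurable]: "q \<in> borel_measurable borel" and loc: "locally_integrable a b q"
    and 0: "\<And>\<phi>. \<phi> \<in> test_functions a b \<Longrightarrow> (LINT x:einterval a b|lborel. q x * \<phi> x) = 0"
  shows "AE x in lborel. x \<in> einterval a b \<longrightarrow> q x = 0"
proof -
  have int: "set_integrable lborel {c..d} q" if "{c..d} \<subseteq> einterval a b" for c d
    using loc that unfolding locally_integrable_def by simp
  have open0: "(LINT x:{c<..<d}|lborel. q x) = 0" if sub: "{c..d} \<subseteq> einterval a b" for c d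
  proof -
    \<comment> \<open>\<open>q\<close> is integrable only over compact sets, so the indicator of the
      closed interval is inserted first; the cut-off \<open>q\<close> then serves as the dominating
      function.\<close>
    have "(\<lambda>n. \<integral>x. indicator {c..d} x *\<^sub>R q x * bump c d n x \<partial>lborel) \<longlonglongrightarrow>
      (\<integral>x. indicator {c..d} x *\<^sub>R q x * indicator {c<..<d} x \<partial>lborel)"
    proof (rule integral_dominated_convergence[where w="\<lambda>x. norm (indicator {c..d} x *\<^sub>R q x)"])
      show "integrable lborel (\<lambda>x. norm (indicator {c..d} x *\<^sub>R q x))"
        using int[OF sub] unfolding set_integrable_def by (rule integrable_norm)
      show "AE x in lborel. (\<lambda>n. indicator {c..d} x *\<^sub>R q x * bump c d n x) \<longlonglongrightarrow> indicator {c..d} x *\<^sub>R q x * indicator {c<..<d} x"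
        by (intro AE_I2 tendsto_mult tendsto_const bump_tendsto)
      show "AE x in lborel. norm (indicator {c..d} x *\<^sub>R q x * bump c d n x) \<le> norm (indicator {c..d} x *\<^sub>R q x)" for n
        using bump_bounds[of c d n] by (auto simp: abs_mult intro!: mult_left_le)
    qed auto
    moreover have "(\<integral>x. indicator {c..d} x *\<^sub>R q x * bump c d n x \<partial>lborel) = 0" for n
    proof -
      have "(\<lambda>x. indicator {c..d} x *\<^sub>R q x * bump c d n x)
          = (\<lambda>x. indicator (einterval a b) x *\<^sub>R (q x * bump c d n x))"
        using subsetD[OF sub] by (fastforce simp: indicator_def bump_def flat_def mult_le_0_iff)
      then show ?thesis
        using 0[OF bump_test_function[OF sub, of n]] unfolding set_lebesgue_integral_def by (simp only:)
    qed
    ultimately have "(\<integral>x. indicator {c..d} x *\<^sub>R q x * indicator {c<..<d} x \<partial>lborel) = 0"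
      by (simp add: LIMSEQ_const_iff)
    moreover have "(\<lambda>x. indicator {c..d} x *\<^sub>R q x * indicator {c<..<d} x) = (\<lambda>x. indicator {c<..<d} x *\<^sub>R q x)"
      by (auto simp: fun_eq_iff indicator_def)
    ultimately show ?thesis
      unfolding set_lebesgue_integral_def by (simp only:)
  qed
  have ae: "AE x in lborel. x \<in> {c..d} \<longrightarrow> q x = 0" if sub: "{c..d} \<subseteq> einterval a b" for c d
  proof -
    have "AE x in lborel. indicator {c..d} x * q x = 0"
    proof (rule integrable_AE_zeroI)
      show "integrable lborel (\<lambda>x. indicator {c..d} x * q x)"
        using int[OF sub] by (simp add: set_integrable_def)
      fix x
      \<comment> \<open>The two domains of integration differ at most in the points \<open>c\<close>
        and \<open>d\<close>.\<close>
      have "(LINT t:{x<..}|lborel. indicator {c..d} t * q t) = (LINT t:{max x c<..<d}|lborel. q t)"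
        unfolding set_lebesgue_integral_def
      proof (rule integral_cong_AE)
        show "AE t in lborel. indicator {x<..} t *\<^sub>R (indicator {c..d} t * q t) = indicator {max x c<..<d} t *\<^sub>R q t"
          using AE_lborel_singleton[of c] AE_lborel_singleton[of d]
          by eventually_elim (auto simp: indicator_def)
      qed auto
      also have "\<dots> = 0"
        by (rule open0) (use sub in auto)
      finally show "(LINT t:{x<..}|lborel. indicator {c..d} t * q t) = 0" .
    qed
    then show ?thesis by eventually_elim (auto simp: indicator_def)
  qed
  \<comment> \<open>Rational endpoints keep the number of exceptional null sets countable, and such
    intervals still surround every point of the open interval.\<close>
  have "AE x in lborel. \<forall>(c, d)\<in>\<rat>\<times>\<rat>. {c..d} \<subseteq> einterval a b \<longrightarrow> x \<in> {c..d} \<longrightarrow> q x = 0"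
  proof (subst AE_ball_countable)
    show "countable (\<rat>\<times>\<rat> :: (real \<times> real) set)" by (simp add: countable_rat)
  qed (use ae in \<open>auto intro!: AE_impI\<close>)
  then show ?thesis
  proof eventually_elim
    case (elim x)
    show ?case
    proof
      assume x: "x \<in> einterval a b"
      then obtain e where e: "e > 0" "\<And>y. \<bar>y - x\<bar> < e \<Longrightarrow> y \<in> einterval a b"
        using open_einterval[of a b] unfolding open_real by metis
      obtain c where c: "c \<in> \<rat>" "x - e < c" "c < x" using Rats_dense_in_real[of "x - e" x] e by auto
      obtain d where d: "d \<in> \<rat>" "x < d" "d < x + e" using Rats_dense_in_real[of x "x + e"] e by auto
      have "{c..d} \<subseteq> einterval a b" using c d by (auto intro!: e(2))
      with elim c d show "q x = 0" by auto
    qed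
  qed
qed

section \<open>Weak derivatives\<close>

lemma test_function_continuous:
  assumes "\<phi> \<in> test_functions a b"
  shows "continuous_on UNIV \<phi>" "continuous_on UNIV (deriv \<phi>)"
    and "(\<phi> has_real_derivative deriv \<phi> x) (at x)"
proof -
  have d: "(deriv ^^ n) \<phi> differentiable_on UNIV" for n
    using assms unfolding test_functions_def by blast
  show "continuous_on UNIV \<phi>" "continuous_on UNIV (deriv \<phi>)"
    using d[of 0] d[of 1] by (auto intro: differentiable_imp_continuous_on)
  show "(\<phi> has_real_derivative deriv \<phi> x) (at x)"
    using d[of 0] by (auto simp: differentiable_on_def intro!: DERIV_deriv_iff_real_differentiable[THEN iffD2])
qed

text \<open>The same \<open>K\<close> serves for the derivative: its complement is open, so
  \<open>\<phi>\<close> is locally zero at each point there.\<close>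

lemma test_function_support:
  assumes "\<phi> \<in> test_functions a b"
  obtains K where "compact K" "K \<subseteq> einterval a b"
    "\<And>x. x \<notin> K \<Longrightarrow> \<phi> x = 0" "\<And>x. x \<notin> K \<Longrightarrow> deriv \<phi> x = 0"
proof -
  obtain K where K: "compact K" "K \<subseteq> einterval a b" "\<And>x. x \<notin> K \<Longrightarrow> \<phi> x = 0"
    using assms unfolding test_functions_def by blast
  have "deriv \<phi> x = 0" if "x \<notin> K" for x
  proof (rule DERIV_imp_deriv)
    have "((\<lambda>_. 0) has_real_derivative 0) (at x)" by simp
    then show "(\<phi> has_real_derivative 0) (at x)"
      by (rule has_field_derivative_transform_within_open[where S="- K"])
        (use that K in \<open>auto simp: compact_imp_closed open_Compl\<close>)
  qed
  with K show ?thesis by (rule that)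
qed

text \<open>The continuous factor is bounded on \<open>K\<close> and vanishes off \<open>K\<close>,
  so the behaviour of \<open>q\<close> near the ends of the interval does not matter.\<close>

lemma locally_integrable_mult:
  assumes q: "locally_integrable a b q" and \<psi>: "continuous_on UNIV \<psi>"
    and K: "compact K" "K \<subseteq> einterval a b" "\<And>x. x \<notin> K \<Longrightarrow> \<psi> x = 0"
  shows "set_integrable lborel (einterval a b) (\<lambda>x. q x * \<psi> x)"
proof -
  have int: "integrable lborel (\<lambda>x. indicator K x * q x)"
    using q K unfolding locally_integrable_def set_integrable_def by simp
  have [measurable]: "\<psi> \<in> borel_measurable borel"
    using \<psi> by (rule borel_measurable_continuous_onI)
  have "bounded (\<psi> ` K)"
    using \<psi> K by (intro compact_imp_bounded compact_continuous_image) (auto intro: continuous_on_subset)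
  then obtain B where B: "\<And>x. x \<in> K \<Longrightarrow> \<bar>\<psi> x\<bar> \<le> B"
    unfolding bounded_real by auto
  \<comment> \<open>Measurability is available only for the restriction of \<open>q\<close> to
    \<open>K\<close>, where it follows from integrability.\<close>
  have [measurable]: "(\<lambda>x. indicator K x * q x) \<in> borel_measurable borel"
    using int by auto
  have "integrable lborel (\<lambda>x. (indicator K x * q x) * \<psi> x)"
  proof (rule Bochner_Integration.integrable_bound[OF integrable_mult_right[OF int, of B]])
    show "AE x in lborel. norm (indicator K x * q x * \<psi> x) \<le> norm (B * (indicator K x * q x))"
    proof (rule AE_I2)
      fix x
      have "\<bar>\<psi> x\<bar> * \<bar>q x\<bar> \<le> \<bar>B\<bar> * \<bar>q x\<bar>" if "x \<in> K"
        using B[OF that] by (intro mult_right_mono) auto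
      then show "norm (indicator K x * q x * \<psi> x) \<le> norm (B * (indicator K x * q x))"
        by (auto simp: indicator_def abs_mult mult.commute)
    qed
  qed measurable
  also have "(\<lambda>x. (indicator K x * q x) * \<psi> x) = (\<lambda>x. indicator (einterval a b) x *\<^sub>R (q x * \<psi> x))"
    using K by (auto simp: fun_eq_iff indicator_def)
  finally show ?thesis unfolding set_integrable_def .
qed

lemma locally_integrable_test_function:
  assumes "locally_integrable a b q" "\<phi> \<in> test_functions a b"
  shows "set_integrable lborel (einterval a b) (\<lambda>x. q x * \<phi> x)"
    and "set_integrable lborel (einterval a b) (\<lambda>x. q x * deriv \<phi> x)"
  using assms test_function_support[OF assms(2)] test_function_continuous[OF assms(2)]
  by (metis locally_integrable_mult)+

lemma locally_integrable_lincomb: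
  assumes "locally_integrable a b p" "locally_integrable a b q"
  shows "locally_integrable a b (\<lambda>x. s * p x + t * q x)"
  using assms unfolding locally_integrable_def by auto

lemma set_integral_lincomb:
  fixes p q :: "real \<Rightarrow> real"
  assumes "set_integrable M A (\<lambda>x. p x * r x)" "set_integrable M A (\<lambda>x. q x * r x)"
  shows "(LINT x:A|M. (s * p x + t * q x) * r x) = s * (LINT x:A|M. p x * r x) + t * (LINT x:A|M. q x * r x)"
proof -
  have "(LINT x:A|M. (s * p x + t * q x) * r x) = (LINT x:A|M. s * (p x * r x) + t * (q x * r x))"
    by (simp add: algebra_simps)
  also have "\<dots> = s * (LINT x:A|M. p x * r x) + t * (LINT x:A|M. q x * r x)"
    using assms by (subst set_integral_add) auto
  finally show ?thesis .
qed

lemma has_weak_deriv_weak_deriv: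
  assumes "has_weak_deriv a b g g'"
  shows "has_weak_deriv a b g (weak_deriv a b g)"
  unfolding weak_deriv_def using someI[of "has_weak_deriv a b g", OF assms] by simp

lemma has_weak_deriv_lincomb:
  assumes p: "has_weak_deriv a b p p'" and q: "has_weak_deriv a b q q'"
  shows "has_weak_deriv a b (\<lambda>x. s * p x + t * q x) (\<lambda>x. s * p' x + t * q' x)"
  unfolding has_weak_deriv_def
proof (intro conjI ballI)
  have [measurable]: "p' \<in> borel_measurable borel" "q' \<in> borel_measurable borel"
    using p q unfolding has_weak_deriv_def by auto
  show "(\<lambda>x. s * p' x + t * q' x) \<in> borel_measurable borel" by measurable
  fix \<phi> assume \<phi>: "\<phi> \<in> test_functions a b"
  show "(LINT x:einterval a b|lborel. (s * p x + t * q x) * deriv \<phi> x) =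
      - (LINT x:einterval a b|lborel. (s * p' x + t * q' x) * \<phi> x)"
    using p q \<phi> unfolding has_weak_deriv_def
    by (simp add: set_integral_lincomb locally_integrable_test_function)
qed (use p q in \<open>auto simp: has_weak_deriv_def intro: locally_integrable_lincomb\<close>)

text \<open>Needed for the summand \<open>u\<close>, which is constant in the \<open>i\<close>-th
  variable. A test function vanishes near the ends, so its derivative integrates to zero.\<close>

lemma has_weak_deriv_const: "has_weak_deriv a b (\<lambda>_. c) (\<lambda>_. 0)"
proof -
  have loc: "locally_integrable a b (\<lambda>_. c)" for c
    unfolding locally_integrable_def set_integrable_def
    by (intro allI impI borel_integrable_compact) auto
  have "(LINT x:einterval a b|lborel. c * deriv \<phi> x) = - (LINT x:einterval a b|lborel. 0 * \<phi> x)"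
    if \<phi>: "\<phi> \<in> test_functions a b" for \<phi>
  proof -
    obtain K where K: "compact K" "K \<subseteq> einterval a b"
      "\<And>x. x \<notin> K \<Longrightarrow> \<phi> x = 0" "\<And>x. x \<notin> K \<Longrightarrow> deriv \<phi> x = 0"
      using test_function_support[OF \<phi>] by metis
    obtain B where B: "B > 0" "\<And>x. x \<in> K \<Longrightarrow> \<bar>x\<bar> \<le> B"
      using compact_imp_bounded[OF K(1)] unfolding bounded_pos by auto
    \<comment> \<open>The added 1 puts both ends strictly outside \<open>K\<close>, so the boundary
      terms of the fundamental theorem of calculus vanish.\<close>
    let ?l = "- (B + 1)" and ?r = "B + 1"
    have out: "?l \<notin> K" "?r \<notin> K" using B by fastforce+
    have "(\<integral>x. deriv \<phi> x * indicator {?l..?r} x \<partial>lborel) = \<phi> ?r - \<phi> ?l"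
      using test_function_continuous[OF \<phi>] B
      by (intro integral_FTC_Icc_real) (auto simp: continuous_on_eq_continuous_at)
    also have "\<dots> = 0" using K out by simp
    also have "(\<lambda>x. deriv \<phi> x * indicator {?l..?r} x) = (\<lambda>x. indicator (einterval a b) x *\<^sub>R deriv \<phi> x)"
    proof
      fix x show "deriv \<phi> x * indicator {?l..?r} x = indicator (einterval a b) x *\<^sub>R deriv \<phi> x"
        using K(2) K(4)[of x] B(2)[of x] by (cases "x \<in> K") (auto simp: indicator_def)
    qed
    finally have "(LINT x:einterval a b|lborel. deriv \<phi> x) = 0"
      unfolding set_lebesgue_integral_def .
    then show ?thesis by simp
  qed
  with loc show ?thesis by (simp add: has_weak_deriv_def)
qed

text \<open>The difference \<open>p - q\<close> is a weak derivative of the zero function, hence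
  orthogonal to all test functions. This is what makes the choice in \<open>weak_deriv\<close>
  immaterial.\<close>

lemma has_weak_deriv_unique:
  assumes p: "has_weak_deriv a b g p" and q: "has_weak_deriv a b g q"
  shows "AE x in lborel. x \<in> einterval a b \<longrightarrow> p x = q x"
proof -
  have d: "has_weak_deriv a b (\<lambda>x. 1 * g x + -1 * g x) (\<lambda>x. 1 * p x + -1 * q x)"
    using p q by (rule has_weak_deriv_lincomb)
  have "AE x in lborel. x \<in> einterval a b \<longrightarrow> 1 * p x + -1 * q x = 0"
    by (rule fundamental_lemma_calculus_of_variations) (use d in \<open>auto simp: has_weak_deriv_def\<close>)
  then show ?thesis by eventually_elim auto
qed

section \<open>The Poincare deficit\<close>

lemma closed_einterval_sets[measurable]: "closed_einterval a b \<in> sets borel"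
  unfolding closed_einterval_def by measurable

text \<open>\<open>\<mu>\<close> is absolutely continuous and lives on the closed interval, which
  exceeds the open one by at most two points.\<close>

lemma measures_P_AE:
  assumes \<mu>: "\<mu> \<in> measures_P a b"
    and P: "AE x in lborel. x \<in> einterval a b \<longrightarrow> P x"
  shows "AE x in \<mu>. P x"
proof -
  obtain \<rho> where \<rho>: "\<rho> \<in> C01_plus a b"
    and eq: "\<mu> = density lborel (\<lambda>x. ennreal (indicator (closed_einterval a b) x * \<rho> x))"
    using \<mu> unfolding measures_P_def by blast
  have "continuous_on (closed_einterval a b) \<rho>"
    using \<rho> unfolding C01_plus_def piecewise_C1_differentiable_on_def by blast
  then have [measurable]: "(\<lambda>x. indicator (closed_einterval a b) x * \<rho> x) \<in> borel_measurable borel"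
    using borel_measurable_continuous_on_indicator[of "closed_einterval a b" \<rho>] by simp
  \<comment> \<open>For an infinite endpoint \<open>real_of_ereal\<close> returns 0; excluding this
    further point costs only a null set.\<close>
  have "AE x in lborel. 0 < ennreal (indicator (closed_einterval a b) x * \<rho> x) \<longrightarrow> P x"
    using P AE_lborel_singleton[of "real_of_ereal a"] AE_lborel_singleton[of "real_of_ereal b"]
  proof eventually_elim
    case (elim x)
    then have "a \<noteq> ereal x" "b \<noteq> ereal x" by auto
    with elim show ?case
      by (auto simp: closed_einterval_def einterval_def indicator_def split: if_splits)
  qed
  then show ?thesis
    unfolding eq by (subst AE_density) auto
qed

lemma measures_P_D:
  assumes "\<mu> \<in> measures_P a b"
  shows "prob_space \<mu>" "sets \<mu> = sets borel"
  using assms unfolding measures_P_def by auto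

text \<open>The extension of a weight beyond the closed interval may have any sign, so nonnegativity
  can only be had almost everywhere.\<close>

lemma weights_nonneg_AE:
  assumes "\<mu> \<in> measures_P a b" "w \<in> weights a b"
  shows "AE x in \<mu>. 0 \<le> w x"
  using assms(2) by (intro measures_P_AE[OF assms(1)] AE_I2) (auto simp: weights_def C01_plus_def less_imp_le)

section \<open>Algebra of square-integrable functions\<close>

lemma L2_measurable: "f \<in> L2 M \<Longrightarrow> f \<in> borel_measurable M"
  and L2_integrable_square: "f \<in> L2 M \<Longrightarrow> integrable M (\<lambda>x. (f x)\<^sup>2)"
  unfolding L2_def by auto

lemma L2_integrable_mult:
  assumes f: "f \<in> L2 M" and g: "g \<in> L2 M"
  shows "integrable M (\<lambda>x. f x * g x)"
proof (rule Bochner_Integration.integrable_bound)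
  show "integrable M (\<lambda>x. (f x)\<^sup>2 + (g x)\<^sup>2)"
    using assms by (auto intro: L2_integrable_square)
  have "\<bar>y * z\<bar> \<le> y\<^sup>2 + z\<^sup>2" for y z :: real
    using sum_squares_bound[of "\<bar>y\<bar>" "\<bar>z\<bar>"] abs_ge_zero[of "y * z"]
    by (simp only: abs_mult power2_abs mult.assoc)
  then show "AE x in M. norm (f x * g x) \<le> norm ((f x)\<^sup>2 + (g x)\<^sup>2)"
    by simp
  show "(\<lambda>x. f x * g x) \<in> borel_measurable M"
    by (intro borel_measurable_times L2_measurable f g)
qed

lemma L2_lincomb:
  assumes f: "f \<in> L2 M" and g: "g \<in> L2 M"
  shows "(\<lambda>x. s * f x + t * g x) \<in> L2 M"
proof -
  have "(s * f x + t * g x)\<^sup>2 = s\<^sup>2 * (f x)\<^sup>2 + t\<^sup>2 * (g x)\<^sup>2 + 2 * s * t * (f x * g x)" for x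
    by (simp add: power2_eq_square algebra_simps)
  moreover have "integrable M (\<lambda>x. s\<^sup>2 * (f x)\<^sup>2 + t\<^sup>2 * (g x)\<^sup>2 + 2 * s * t * (f x * g x))"
    using assms by (intro Bochner_Integration.integrable_add integrable_mult_right L2_integrable_square L2_integrable_mult)
  ultimately show ?thesis
    using assms by (auto simp: L2_def)
qed

lemma integral_square_lincomb:
  assumes f: "f \<in> L2 M" and g: "g \<in> L2 M"
  shows "(\<integral>x. (f x + s * g x)\<^sup>2 \<partial>M) = (\<integral>x. (f x)\<^sup>2 \<partial>M) + 2 * s * (\<integral>x. f x * g x \<partial>M) + s\<^sup>2 * (\<integral>x. (g x)\<^sup>2 \<partial>M)"
proof -
  have "(\<integral>x. (f x + s * g x)\<^sup>2 \<partial>M) = (\<integral>x. (f x)\<^sup>2 + (2 * s * (f x * g x) + s\<^sup>2 * (g x)\<^sup>2) \<partial>M)"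
    by (simp add: power2_eq_square algebra_simps)
  also have "\<dots> = (\<integral>x. (f x)\<^sup>2 \<partial>M) + 2 * s * (\<integral>x. f x * g x \<partial>M) + s\<^sup>2 * (\<integral>x. (g x)\<^sup>2 \<partial>M)"
    using L2_integrable_square[OF f] L2_integrable_square[OF g] L2_integrable_mult[OF f g]
    by (subst Bochner_Integration.integral_add, simp_all)+
  finally show ?thesis .
qed

lemma (in finite_measure) L2_integrable:
  assumes "f \<in> L2 M"
  shows "integrable M f"
  using square_integrable_imp_integrable[OF L2_measurable[OF assms] L2_integrable_square[OF assms]] .

section \<open>The weighted Sobolev space and its energy\<close>

lemma H1_has_weak_deriv:
  assumes "g \<in> H1 a b \<mu> w"
  shows "has_weak_deriv a b g (weak_deriv a b g)"
  using assms has_weak_deriv_weak_deriv unfolding H1_def by blast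

lemma H1_D:
  assumes "g \<in> H1 a b \<mu> w"
  shows "g \<in> L2 \<mu>" "(\<lambda>x. sqrt (w x) * weak_deriv a b g x) \<in> L2 \<mu>"
    "weak_deriv a b g \<in> borel_measurable borel"
  using assms H1_has_weak_deriv[OF assms] unfolding H1_def has_weak_deriv_def by auto

text \<open>As a choice, \<open>weak_deriv\<close> is linear only up to null sets: both the chosen
  derivative and the obvious combination are weak derivatives of the same function. Membership,
  which refers to the chosen one, is then transferred along this equality.\<close>

lemma H1_lincomb:
  assumes \<mu>: "\<mu> \<in> measures_P a b" and w: "w \<in> weights a b"
    and g: "g \<in> H1 a b \<mu> w" and h: "h \<in> H1 a b \<mu> w"
  shows "(\<lambda>x. s * h x + t * g x) \<in> H1 a b \<mu> w"
    and "AE x in \<mu>. weak_deriv a b (\<lambda>x. s * h x + t * g x) x = s * weak_deriv a b h x + t * weak_deriv a b g x"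
proof -
  let ?k = "\<lambda>x. s * h x + t * g x" and ?k' = "\<lambda>x. s * weak_deriv a b h x + t * weak_deriv a b g x"
  note [measurable_cong] = measures_P_D(2)[OF \<mu>]
  have [measurable]: "w \<in> borel_measurable borel" using w by (simp add: weights_def)
  note [measurable] = H1_D(3)[OF g] H1_D(3)[OF h]
  have wd: "has_weak_deriv a b ?k ?k'"
    by (intro has_weak_deriv_lincomb H1_has_weak_deriv[OF g] H1_has_weak_deriv[OF h])
  then have wd': "has_weak_deriv a b ?k (weak_deriv a b ?k)"
    by (rule has_weak_deriv_weak_deriv)
  then have [measurable]: "weak_deriv a b ?k \<in> borel_measurable borel"
    by (simp add: has_weak_deriv_def)
  show eq: "AE x in \<mu>. weak_deriv a b ?k x = ?k' x"
    by (rule measures_P_AE[OF \<mu> has_weak_deriv_unique[OF wd' wd]])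
  have L2: "(\<lambda>x. s * (sqrt (w x) * weak_deriv a b h x) + t * (sqrt (w x) * weak_deriv a b g x)) \<in> L2 \<mu>"
    by (intro L2_lincomb H1_D(2)[OF g] H1_D(2)[OF h])
  have "integrable \<mu> (\<lambda>x. (sqrt (w x) * weak_deriv a b ?k x)\<^sup>2)"
  proof (subst integrable_cong_AE)
    show "AE x in \<mu>. (sqrt (w x) * weak_deriv a b ?k x)\<^sup>2 =
        (s * (sqrt (w x) * weak_deriv a b h x) + t * (sqrt (w x) * weak_deriv a b g x))\<^sup>2"
      using eq by eventually_elim (simp add: algebra_simps)
    show "integrable \<mu> (\<lambda>x. (s * (sqrt (w x) * weak_deriv a b h x) + t * (sqrt (w x) * weak_deriv a b g x))\<^sup>2)"
      by (rule L2_integrable_square[OF L2])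
  qed measurable
  then have "(\<lambda>x. sqrt (w x) * weak_deriv a b ?k x) \<in> L2 \<mu>"
    unfolding L2_def by simp
  then show "?k \<in> H1 a b \<mu> w"
    unfolding H1_def using wd L2_lincomb[OF H1_D(1)[OF h] H1_D(1)[OF g]] by blast
qed

text \<open>\<open>sqrt\<close> is an odd function on the reals, so the square of
  \<open>sqrt (w x)\<close> is the absolute value of \<open>w x\<close>; the identity relies on the
  weight being nonnegative almost everywhere.\<close>

lemma weighted_energy_eq:
  assumes \<mu>: "\<mu> \<in> measures_P a b" and w: "w \<in> weights a b" and q[measurable]: "q \<in> borel_measurable borel"
  shows "(\<integral>x. w x * (q x)\<^sup>2 \<partial>\<mu>) = (\<integral>x. (sqrt (w x) * q x)\<^sup>2 \<partial>\<mu>)"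
proof (rule integral_cong_AE)
  note [measurable_cong] = measures_P_D(2)[OF \<mu>]
  have [measurable]: "w \<in> borel_measurable borel" using w by (simp add: weights_def)
  show "(\<lambda>x. w x * (q x)\<^sup>2) \<in> borel_measurable \<mu>" "(\<lambda>x. (sqrt (w x) * q x)\<^sup>2) \<in> borel_measurable \<mu>"
    by measurable
  show "AE x in \<mu>. w x * (q x)\<^sup>2 = (sqrt (w x) * q x)\<^sup>2"
    using weights_nonneg_AE[OF \<mu> w] by eventually_elim (simp add: power_mult_distrib)
qed

text \<open>The vanishing of the cross term is the weak Euler-Lagrange equation of the saturating
  function, E(h g) = C E(w h' g') for every centered \<open>h\<close>. It is obtained by perturbing
  \<open>h\<close> in the direction \<open>g\<close>.\<close>

lemma poincare_deficit_bounds: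
  assumes \<mu>: "\<mu> \<in> measures_P a b" and w: "w \<in> weights a b"
    and C: "poincare_inequality a b \<mu> w C"
    and g: "g \<in> H1 a b \<mu> w" "centered \<mu> g"
      "(\<integral>x. (g x)\<^sup>2 \<partial>\<mu>) = C * (\<integral>x. w x * (weak_deriv a b g x)\<^sup>2 \<partial>\<mu>)"
    and h: "h \<in> H1 a b \<mu> w" "centered \<mu> h"
  shows "(\<integral>x. (h x)\<^sup>2 \<partial>\<mu>) \<le> C * (\<integral>x. w x * (weak_deriv a b h x)\<^sup>2 \<partial>\<mu>)"
    and "C * (\<integral>x. w x * (weak_deriv a b h x)\<^sup>2 \<partial>\<mu>) - (\<integral>x. (h x)\<^sup>2 \<partial>\<mu>)
      \<le> C * (\<integral>x. w x * (weak_deriv a b h x - weak_deriv a b g x)\<^sup>2 \<partial>\<mu>)"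
proof -
  interpret prob_space \<mu> by (rule measures_P_D(1)[OF \<mu>])
  note [measurable_cong] = measures_P_D(2)[OF \<mu>]
  have [measurable]: "w \<in> borel_measurable borel" using w by (simp add: weights_def)
  let ?g' = "weak_deriv a b g" and ?h' = "weak_deriv a b h"
  note [measurable] = H1_D(3)[OF g(1)] H1_D(3)[OF h(1)]
  define G where "G x = sqrt (w x) * ?g' x" for x
  define H where "H x = sqrt (w x) * ?h' x" for x
  have G: "G \<in> L2 \<mu>" and H: "H \<in> L2 \<mu>"
    unfolding G_def[abs_def] H_def[abs_def] by (rule H1_D(2)[OF g(1)] H1_D(2)[OF h(1)])+
  \<comment> \<open>\<open>Q\<close> is the deficit of \<open>h\<close>, and \<open>B\<close> is the
    associated bilinear form at the pair of \<open>h\<close> and \<open>g\<close>.\<close>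
  define Q where "Q = C * (\<integral>x. (H x)\<^sup>2 \<partial>\<mu>) - (\<integral>x. (h x)\<^sup>2 \<partial>\<mu>)"
  define B where "B = C * (\<integral>x. H x * G x \<partial>\<mu>) - (\<integral>x. h x * g x \<partial>\<mu>)"
  have g0: "(\<integral>x. (g x)\<^sup>2 \<partial>\<mu>) = C * (\<integral>x. (G x)\<^sup>2 \<partial>\<mu>)"
    using g(3) unfolding weighted_energy_eq[OF \<mu> w H1_D(3)[OF g(1)]] G_def .
  have en: "(\<integral>x. w x * (?h' x + s * ?g' x)\<^sup>2 \<partial>\<mu>)
      = (\<integral>x. (H x)\<^sup>2 \<partial>\<mu>) + 2 * s * (\<integral>x. H x * G x \<partial>\<mu>) + s\<^sup>2 * (\<integral>x. (G x)\<^sup>2 \<partial>\<mu>)" for s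
  proof -
    have "(\<integral>x. w x * (?h' x + s * ?g' x)\<^sup>2 \<partial>\<mu>) = (\<integral>x. (sqrt (w x) * (?h' x + s * ?g' x))\<^sup>2 \<partial>\<mu>)"
      by (rule weighted_energy_eq[OF \<mu> w]) measurable
    also have "\<dots> = (\<integral>x. (H x + s * G x)\<^sup>2 \<partial>\<mu>)"
      by (simp add: H_def G_def algebra_simps)
    finally show ?thesis unfolding integral_square_lincomb[OF H G] .
  qed
  have nonneg: "0 \<le> Q + 2 * s * B" for s
  proof -
    let ?k = "\<lambda>x. 1 * h x + s * g x"
    note k = H1_lincomb[OF \<mu> w g(1) h(1), of 1 s]
    have [measurable]: "weak_deriv a b ?k \<in> borel_measurable borel"
      by (rule H1_D(3)[OF k(1)])
    have "centered \<mu> ?k"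
      using g(2) h(2) L2_integrable[OF H1_D(1)[OF g(1)]] L2_integrable[OF H1_D(1)[OF h(1)]]
      unfolding centered_def by simp
    with C k(1) have "(\<integral>x. (?k x)\<^sup>2 \<partial>\<mu>) \<le> C * (\<integral>x. w x * (weak_deriv a b ?k x)\<^sup>2 \<partial>\<mu>)"
      unfolding poincare_inequality_def by blast
    also have "(\<integral>x. w x * (weak_deriv a b ?k x)\<^sup>2 \<partial>\<mu>) = (\<integral>x. w x * (?h' x + s * ?g' x)\<^sup>2 \<partial>\<mu>)"
    proof (rule integral_cong_AE)
      show "AE x in \<mu>. w x * (weak_deriv a b ?k x)\<^sup>2 = w x * (?h' x + s * ?g' x)\<^sup>2"
        using k(2) by eventually_elim simp
    qed measurable
    finally show ?thesis
      using integral_square_lincomb[OF H1_D(1)[OF h(1)] H1_D(1)[OF g(1)], of s]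
      unfolding en g0 Q_def B_def by (simp add: algebra_simps)
  qed
  have "B = 0"
  proof (rule ccontr)
    assume "B \<noteq> 0"
    \<comment> \<open>The parameter solves \<open>Q + 2 * s * B = - 1\<close>, contradicting
      nonnegativity.\<close>
    then have "Q + 2 * (- (Q + 1) / (2 * B)) * B = - 1" by (simp add: field_simps)
    with nonneg[of "- (Q + 1) / (2 * B)"] show False by simp
  qed
  have Qh: "Q = C * (\<integral>x. w x * (?h' x)\<^sup>2 \<partial>\<mu>) - (\<integral>x. (h x)\<^sup>2 \<partial>\<mu>)"
    using en[of 0] unfolding Q_def by simp
  then show "(\<integral>x. (h x)\<^sup>2 \<partial>\<mu>) \<le> C * (\<integral>x. w x * (?h' x)\<^sup>2 \<partial>\<mu>)"
    using nonneg[of 0] by simp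
  have "(\<integral>x. w x * (?h' x - ?g' x)\<^sup>2 \<partial>\<mu>)
      = (\<integral>x. (H x)\<^sup>2 \<partial>\<mu>) - 2 * (\<integral>x. H x * G x \<partial>\<mu>) + (\<integral>x. (G x)\<^sup>2 \<partial>\<mu>)"
    using en[of "-1"] by simp
  then have "C * (\<integral>x. w x * (?h' x - ?g' x)\<^sup>2 \<partial>\<mu>)
      = C * (\<integral>x. (H x)\<^sup>2 \<partial>\<mu>) - 2 * (C * (\<integral>x. H x * G x \<partial>\<mu>)) + C * (\<integral>x. (G x)\<^sup>2 \<partial>\<mu>)"
    by (simp only: distrib_left right_diff_distrib mult.left_commute[of C 2])
  \<comment> \<open>The deficits of \<open>h\<close> and \<open>h - g\<close> agree once
    \<open>B = 0\<close>; discarding the second moment of \<open>h - g\<close> leaves only its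
    energy as the bound.\<close>
  moreover have "0 \<le> (\<integral>x. (h x + (-1) * g x)\<^sup>2 \<partial>\<mu>)" by simp
  ultimately show "C * (\<integral>x. w x * (?h' x)\<^sup>2 \<partial>\<mu>) - (\<integral>x. (h x)\<^sup>2 \<partial>\<mu>) \<le> C * (\<integral>x. w x * (?h' x - ?g' x)\<^sup>2 \<partial>\<mu>)"
    using \<open>B = 0\<close>
    unfolding Qh[symmetric] integral_square_lincomb[OF H1_D(1)[OF h(1)] H1_D(1)[OF g(1)]] g0 B_def Q_def
    by simp
qed

section \<open>Independent coordinates\<close>

lemma omit_measurable: "omit i \<in> measurable borel (omit_space i)"
  unfolding omit_def[abs_def] omit_space_def by measurable

lemma insert_coord_measurable[measurable]:
  "(\<lambda>p. insert_coord i (fst p) (snd p)) \<in> borel_measurable (omit_space i \<Otimes>\<^sub>M borel)"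
proof (subst borel_measurable_euclidean_space, intro ballI)
  fix e :: "real ^ 'a" assume "e \<in> Basis"
  then obtain j where e: "e = axis j 1" unfolding Basis_vec_def by auto
  have "(\<lambda>p. fst p j) \<in> borel_measurable (omit_space i \<Otimes>\<^sub>M borel)" if "j \<noteq> i"
    unfolding omit_space_def
    by (rule measurable_compose[OF measurable_fst measurable_component_singleton]) (use that in auto)
  then show "(\<lambda>p. insert_coord i (fst p) (snd p) \<bullet> e) \<in> borel_measurable (omit_space i \<Otimes>\<^sub>M borel)"
    unfolding e by (cases "j = i") (auto simp: insert_coord_def inner_axis)
qed

lemma insert_coord_omit: "insert_coord i (omit i x) (x $ i) = x"
  by (simp add: insert_coord_def omit_def vec_eq_iff)

lemma omit_insert_coord: "z \<in> space (omit_space i) \<Longrightarrow> omit i (insert_coord i z t) = z"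
  by (auto simp: omit_def insert_coord_def omit_space_def space_PiM PiE_def extensional_def fun_eq_iff)

section \<open>Random vectors with independent coordinates\<close>

locale indep_coordinates = prob_space M for M :: "'a measure" +
  fixes X :: "'a \<Rightarrow> real ^ 'n::finite"
  assumes indep: "indep_vars (\<lambda>_. borel) (\<lambda>j \<omega>. X \<omega> $ j) UNIV"
begin

lemma coord_measurable[measurable]: "(\<lambda>\<omega>. X \<omega> $ i) \<in> borel_measurable M"
  using indep by (simp add: indep_vars_def)

lemma X_measurable[measurable]: "X \<in> borel_measurable M"
proof (subst borel_measurable_euclidean_space, intro ballI)
  fix e :: "real ^ 'n" assume "e \<in> Basis"
  then obtain j where "e = axis j 1" unfolding Basis_vec_def by auto
  then show "(\<lambda>\<omega>. X \<omega> \<bullet> e) \<in> borel_measurable M"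
    by (simp add: inner_axis)
qed

lemma omit_X_measurable[measurable]: "(\<lambda>\<omega>. omit i (X \<omega>)) \<in> measurable M (omit_space i)"
  by (rule measurable_compose[OF X_measurable omit_measurable])

text \<open>Independence of disjoint blocks speaks of product spaces, so the single coordinate
  appears as a function on \<open>{i}\<close>; evaluation at \<open>i\<close> recovers the real
  variable.\<close>

lemma indep_omit_coord:
  "indep_var (omit_space i) (\<lambda>\<omega>. omit i (X \<omega>)) (PiM {i} (\<lambda>_. borel)) (\<lambda>\<omega>. \<lambda>j\<in>{i}. X \<omega> $ j)"
  unfolding omit_space_def omit_def by (rule indep_var_restrict[OF indep]) auto

text \<open>Under independence a product of integrable variables is integrable, so squares of L2
  functions can be factored without fourth moments.\<close>

lemma omit_coord_product:
  fixes p :: "('n \<Rightarrow> real) \<Rightarrow> real" and q :: "real \<Rightarrow> real"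
  assumes p: "p \<in> borel_measurable (omit_space i)" and q[measurable]: "q \<in> borel_measurable borel"
    and int: "integrable M (\<lambda>\<omega>. p (omit i (X \<omega>)))" "integrable M (\<lambda>\<omega>. q (X \<omega> $ i))"
  shows "integrable M (\<lambda>\<omega>. q (X \<omega> $ i) * p (omit i (X \<omega>)))"
    and "expectation (\<lambda>\<omega>. q (X \<omega> $ i) * p (omit i (X \<omega>)))
      = expectation (\<lambda>\<omega>. q (X \<omega> $ i)) * expectation (\<lambda>\<omega>. p (omit i (X \<omega>)))"
proof -
  have "(\<lambda>y. q (y i)) \<in> borel_measurable (PiM {i} (\<lambda>_. borel))" by measurable
  from indep_var_compose[OF indep_omit_coord p this]
  have "indep_var borel (\<lambda>\<omega>. p (omit i (X \<omega>))) borel (\<lambda>\<omega>. q (X \<omega> $ i))"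
    by (simp add: comp_def)
  from indep_var_integrable[OF this int] indep_var_lebesgue_integral[OF this int]
  show "integrable M (\<lambda>\<omega>. q (X \<omega> $ i) * p (omit i (X \<omega>)))"
    and "expectation (\<lambda>\<omega>. q (X \<omega> $ i) * p (omit i (X \<omega>)))
      = expectation (\<lambda>\<omega>. q (X \<omega> $ i)) * expectation (\<lambda>\<omega>. p (omit i (X \<omega>)))"
    by (simp_all add: mult.commute)
qed

text \<open>Fubini for null sets: by independence the joint law of the two blocks is the product of
  their laws, so a null set may be checked section by section.\<close>

lemma AE_omit_coordI:
  assumes [measurable]: "Measurable.pred (omit_space i \<Otimes>\<^sub>M borel) P"
    and AE: "AE z in distr M (omit_space i) (\<lambda>\<omega>. omit i (X \<omega>)). AE t in distr M borel (\<lambda>\<omega>. X \<omega> $ i). P (z, t)"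
  shows "AE \<omega> in M. P (omit i (X \<omega>), X \<omega> $ i)"
proof -
  let ?N = "distr M (omit_space i) (\<lambda>\<omega>. omit i (X \<omega>))"
  let ?\<mu> = "distr M (PiM {i} (\<lambda>_. borel)) (\<lambda>\<omega>. \<lambda>j\<in>{i}. X \<omega> $ j)"
  interpret N: prob_space ?N by (rule prob_space_distr) measurable
  interpret \<mu>: prob_space ?\<mu> by (rule prob_space_distr) measurable
  interpret P: pair_sigma_finite ?N ?\<mu> ..
  have "AE z in ?N. AE y in ?\<mu>. P (z, y i)"
    using AE AE_space
  proof eventually_elim
    case (elim z)
    then have [measurable]: "z \<in> space (omit_space i)" by simp
    show ?case
      using elim(1) by (simp add: AE_distr_iff)
  qed
  moreover have "Measurable.pred (omit_space i \<Otimes>\<^sub>M PiM {i} (\<lambda>_. borel)) (\<lambda>x. P (fst x, snd x i))"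
    by measurable
  ultimately have "AE x in ?N \<Otimes>\<^sub>M ?\<mu>. P (fst x, snd x i)"
    by (intro P.AE_pair_measure) (simp_all add: pred_def space_pair_measure)
  then have "AE x in distr M (omit_space i \<Otimes>\<^sub>M PiM {i} (\<lambda>_. borel)) (\<lambda>\<omega>. (omit i (X \<omega>), \<lambda>j\<in>{i}. X \<omega> $ j)).
      P (fst x, snd x i)"
    using indep_omit_coord[of i, unfolded indep_var_distribution_eq, THEN conjunct2, THEN conjunct2]
    by (simp only:)
  from AE_distrD[OF _ this] show ?thesis by simp
qed

text \<open>A set of the conditioning sigma-algebra is a preimage of some \<open>B\<close> under the
  omitted coordinates. Its indicator joins \<open>v\<close> in one factor, and independence leaves
  E(h) = 0 as the other, so the second summand integrates to zero.\<close>

lemma real_cond_exp_separated: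
  fixes u v :: "('n \<Rightarrow> real) \<Rightarrow> real" and h :: "real \<Rightarrow> real"
  assumes [measurable]: "u \<in> borel_measurable (omit_space i)" "v \<in> borel_measurable (omit_space i)"
      "h \<in> borel_measurable borel"
    and u: "integrable M (\<lambda>\<omega>. u (omit i (X \<omega>)))" and v: "integrable M (\<lambda>\<omega>. v (omit i (X \<omega>)))"
    and h: "integrable M (\<lambda>\<omega>. h (X \<omega> $ i))" and h0: "expectation (\<lambda>\<omega>. h (X \<omega> $ i)) = 0"
  shows "AE \<omega> in M. real_cond_exp M (vimage_algebra (space M) (\<lambda>\<omega>. omit i (X \<omega>)) (omit_space i))
    (\<lambda>\<omega>. u (omit i (X \<omega>)) + h (X \<omega> $ i) * v (omit i (X \<omega>))) \<omega> = u (omit i (X \<omega>))"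
proof -
  define Z where "Z = (\<lambda>\<omega>. omit i (X \<omega>))"
  define N where "N = (omit_space i :: ('n \<Rightarrow> real) measure)"
  have Z[measurable]: "Z \<in> measurable M N" unfolding Z_def N_def by measurable
  have [measurable]: "u \<in> borel_measurable N" "v \<in> borel_measurable N"
    using assms unfolding N_def by auto
  have uZ: "integrable M (\<lambda>\<omega>. u (Z \<omega>))" and vZ: "integrable M (\<lambda>\<omega>. v (Z \<omega>))"
    using u v unfolding Z_def .
  let ?F = "vimage_algebra (space M) Z N"
  have ZF: "Z \<in> space M \<rightarrow> space N" using measurable_space[OF Z] by auto
  have ZFm[measurable]: "Z \<in> measurable ?F N" by (rule measurable_vimage_algebra1[OF ZF])
  have "subalgebra M ?F"
    unfolding subalgebra_def
    by (auto simp: sets_vimage_algebra2[OF ZF] intro: measurable_sets[OF Z])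
  then interpret F: finite_measure_subalgebra M ?F
    by unfold_locales
  have "AE \<omega> in M. real_cond_exp M ?F (\<lambda>\<omega>. u (Z \<omega>) + h (X \<omega> $ i) * v (Z \<omega>)) \<omega> = u (Z \<omega>)"
  proof (rule F.real_cond_exp_charact)
    show "integrable M (\<lambda>\<omega>. u (Z \<omega>) + h (X \<omega> $ i) * v (Z \<omega>))"
      unfolding Z_def by (intro Bochner_Integration.integrable_add u omit_coord_product(1) v h) measurable
    show "(\<lambda>\<omega>. u (Z \<omega>)) \<in> borel_measurable ?F" by measurable
    fix A assume "A \<in> sets ?F"
    then obtain B where B[measurable]: "B \<in> sets N" and A: "A = Z -` B \<inter> space M"
      unfolding sets_vimage_algebra2[OF ZF] by blast
    have [measurable]: "A \<in> sets M" unfolding A by measurable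
    have vB: "integrable M (\<lambda>\<omega>. indicator B (Z \<omega>) * v (Z \<omega>))"
      by (rule Bochner_Integration.integrable_bound[OF vZ]) (auto simp: indicator_def)
    have "(\<lambda>z. indicator B z * v z) \<in> borel_measurable N" by measurable
    note hv = omit_coord_product[OF this[unfolded N_def] _ vB[unfolded Z_def] h, folded Z_def, simplified h0]
    have uA: "integrable M (\<lambda>\<omega>. indicator A \<omega> * u (Z \<omega>))"
      by (rule Bochner_Integration.integrable_bound[OF uZ]) (auto simp: indicator_def)
    have "(\<integral>\<omega>\<in>A. (u (Z \<omega>) + h (X \<omega> $ i) * v (Z \<omega>)) \<partial>M)
        = (\<integral>\<omega>. indicator A \<omega> * u (Z \<omega>) + h (X \<omega> $ i) * (indicator B (Z \<omega>) * v (Z \<omega>)) \<partial>M)"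
      unfolding set_lebesgue_integral_def
      by (rule Bochner_Integration.integral_cong) (auto simp: A indicator_def)
    also have "\<dots> = (\<integral>\<omega>. indicator A \<omega> * u (Z \<omega>) \<partial>M)"
      using hv uA unfolding Z_def by simp
    finally show "(\<integral>\<omega>\<in>A. (u (Z \<omega>) + h (X \<omega> $ i) * v (Z \<omega>)) \<partial>M) = (\<integral>\<omega>\<in>A. u (Z \<omega>) \<partial>M)"
      unfolding set_lebesgue_integral_def by simp
  qed (rule uZ)
  then show ?thesis unfolding Z_def N_def .
qed

text \<open>The product \<open>h v\<close> has mean E(h) E(v) = 0, so the variance is a second
  moment, which factors.\<close>

lemma variance_total_effect_separated:
  fixes f :: "real ^ 'n \<Rightarrow> real"
  assumes f: "\<And>x. f x = u (omit i x) + h (x $ i) * v (omit i x)"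
    and u[measurable]: "u \<in> borel_measurable (omit_space i)"
    and v[measurable]: "v \<in> borel_measurable (omit_space i)"
    and h[measurable]: "h \<in> borel_measurable borel"
    and u_L2: "(\<lambda>\<omega>. u (omit i (X \<omega>))) \<in> L2 M" and v_L2: "(\<lambda>\<omega>. v (omit i (X \<omega>))) \<in> L2 M"
    and h_L2: "(\<lambda>\<omega>. h (X \<omega> $ i)) \<in> L2 M" and h0: "expectation (\<lambda>\<omega>. h (X \<omega> $ i)) = 0"
  shows "variance (total_effect M X i f)
    = expectation (\<lambda>\<omega>. (h (X \<omega> $ i))\<^sup>2) * expectation (\<lambda>\<omega>. (v (omit i (X \<omega>)))\<^sup>2)"
proof -
  let ?T = "total_effect M X i f" and ?P = "\<lambda>\<omega>. h (X \<omega> $ i) * v (omit i (X \<omega>))"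
  have [measurable]: "?T \<in> borel_measurable M"
    unfolding total_effect_def f by measurable
  have TP: "AE \<omega> in M. ?T \<omega> = ?P \<omega>"
    using real_cond_exp_separated[OF u v h L2_integrable[OF u_L2] L2_integrable[OF v_L2] L2_integrable[OF h_L2] h0]
    unfolding total_effect_def f by eventually_elim simp
  have "expectation ?T = expectation ?P"
    by (rule integral_cong_AE[OF _ _ TP]) measurable
  also have "\<dots> = 0"
    using omit_coord_product(2)[OF v h L2_integrable[OF v_L2] L2_integrable[OF h_L2]] h0 by simp
  finally have "variance ?T = expectation (\<lambda>\<omega>. (?T \<omega>)\<^sup>2)" by simp
  also have "\<dots> = expectation (\<lambda>\<omega>. (h (X \<omega> $ i))\<^sup>2 * (v (omit i (X \<omega>)))\<^sup>2)"
  proof (rule integral_cong_AE)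
    show "AE \<omega> in M. (?T \<omega>)\<^sup>2 = (h (X \<omega> $ i))\<^sup>2 * (v (omit i (X \<omega>)))\<^sup>2"
      using TP by eventually_elim (simp add: power_mult_distrib)
  qed measurable
  also have "\<dots> = expectation (\<lambda>\<omega>. (h (X \<omega> $ i))\<^sup>2) * expectation (\<lambda>\<omega>. (v (omit i (X \<omega>)))\<^sup>2)"
    by (rule omit_coord_product(2)[where p="\<lambda>z. (v z)\<^sup>2" and q="\<lambda>t. (h t)\<^sup>2"])
      (use L2_integrable_square[OF v_L2] L2_integrable_square[OF h_L2] in auto)
  finally show ?thesis .
qed

text \<open>Uniqueness holds on each section with the omitted coordinates fixed; joint measurability
  of \<open>D\<close> allows the sections to be glued by \<open>AE_omit_coordI\<close>.\<close>

lemma weak_partial_separated: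
  fixes f D :: "real ^ 'n \<Rightarrow> real"
  assumes \<mu>: "distr M borel (\<lambda>\<omega>. X \<omega> $ i) \<in> measures_P a b"
    and D: "is_weak_partial M X i a b f D"
    and f: "\<And>x. f x = u (omit i x) + h (x $ i) * v (omit i x)"
    and v[measurable]: "v \<in> borel_measurable (omit_space i)"
    and h: "has_weak_deriv a b h h'"
  shows "AE \<omega> in M. D (X \<omega>) = v (omit i (X \<omega>)) * h' (X \<omega> $ i)"
proof -
  have [measurable]: "D \<in> borel_measurable borel" "h' \<in> borel_measurable borel"
    using D h unfolding is_weak_partial_def has_weak_deriv_def by auto
  have "AE z in distr M (omit_space i) (\<lambda>\<omega>. omit i (X \<omega>)). AE t in distr M borel (\<lambda>\<omega>. X \<omega> $ i). D (insert_coord i z t) = v z * h' t"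
    using D[unfolded is_weak_partial_def, THEN conjunct2] AE_space
  proof eventually_elim
    case (elim z)
    have "has_weak_deriv a b (\<lambda>t. v z * h t + 1 * u z) (\<lambda>t. v z * h' t + 1 * 0)"
      by (intro has_weak_deriv_lincomb h has_weak_deriv_const)
    \<comment> \<open>Omitting undoes inserting only for \<open>z\<close> in the product space,
      whose members are \<open>undefined\<close> at \<open>i\<close>; hence the appeal to
      \<open>AE_space\<close>.\<close>
    moreover have "(\<lambda>t. f (insert_coord i z t)) = (\<lambda>t. v z * h t + 1 * u z)"
      using elim(2) by (simp add: f omit_insert_coord fun_eq_iff) (simp add: insert_coord_def)
    ultimately have "has_weak_deriv a b (\<lambda>t. f (insert_coord i z t)) (\<lambda>t. v z * h' t)" by simp
    from measures_P_AE[OF \<mu> has_weak_deriv_unique[OF elim(1) this]] show ?case .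
  qed
  then have "AE \<omega> in M. (\<lambda>p. D (insert_coord i (fst p) (snd p)) = v (fst p) * h' (snd p)) (omit i (X \<omega>), X \<omega> $ i)"
    by (intro AE_omit_coordI) simp_all
  then show ?thesis by (simp add: insert_coord_omit)
qed

lemma weighted_dgsm_separated:
  fixes f D :: "real ^ 'n \<Rightarrow> real"
  assumes \<mu>_def: "\<mu> = distr M borel (\<lambda>\<omega>. X \<omega> $ i)"
    and \<mu>: "\<mu> \<in> measures_P a b" and w: "w \<in> weights a b"
    and D: "is_weak_partial M X i a b f D"
    and f: "\<And>x. f x = u (omit i x) + h (x $ i) * v (omit i x)"
    and v[measurable]: "v \<in> borel_measurable (omit_space i)"
    and v_L2: "(\<lambda>\<omega>. v (omit i (X \<omega>))) \<in> L2 M"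
    and h: "h \<in> H1 a b \<mu> w"
  shows "weighted_dgsm M X i w D
    = (\<integral>x. w x * (weak_deriv a b h x)\<^sup>2 \<partial>\<mu>) * expectation (\<lambda>\<omega>. (v (omit i (X \<omega>)))\<^sup>2)"
proof -
  have [measurable]: "w \<in> borel_measurable borel" "D \<in> borel_measurable borel" "weak_deriv a b h \<in> borel_measurable borel"
    using w D H1_D(3)[OF h] by (auto simp: weights_def is_weak_partial_def)
  \<comment> \<open>This form of the energy density is the one whose integrability \<open>H1\<close>
    supplies.\<close>
  let ?H = "\<lambda>x. (sqrt (w x) * weak_deriv a b h x)\<^sup>2"
  have H: "integrable M (\<lambda>\<omega>. ?H (X \<omega> $ i))"
    using L2_integrable_square[OF H1_D(2)[OF h]] unfolding \<mu>_def by (rule integrable_distr[OF coord_measurable])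
  have "AE \<omega> in M. 0 \<le> w (X \<omega> $ i)"
    using weights_nonneg_AE[OF \<mu> w] unfolding \<mu>_def by (rule AE_distrD[OF coord_measurable])
  then have "AE \<omega> in M. w (X \<omega> $ i) * (D (X \<omega>))\<^sup>2 = ?H (X \<omega> $ i) * (v (omit i (X \<omega>)))\<^sup>2"
    using weak_partial_separated[OF \<mu>[unfolded \<mu>_def] D f v H1_has_weak_deriv[OF h]]
    by eventually_elim (simp add: power_mult_distrib)
  then have "weighted_dgsm M X i w D = expectation (\<lambda>\<omega>. ?H (X \<omega> $ i) * (v (omit i (X \<omega>)))\<^sup>2)"
    unfolding weighted_dgsm_def by (intro integral_cong_AE) measurable
  also have "\<dots> = expectation (\<lambda>\<omega>. ?H (X \<omega> $ i)) * expectation (\<lambda>\<omega>. (v (omit i (X \<omega>)))\<^sup>2)"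
    by (rule omit_coord_product(2)[where p="\<lambda>z. (v z)\<^sup>2" and q="?H"])
      (use L2_integrable_square[OF v_L2] H in auto)
  also have "expectation (\<lambda>\<omega>. ?H (X \<omega> $ i)) = (\<integral>x. ?H x \<partial>\<mu>)"
    unfolding \<mu>_def by (subst integral_distr) auto
  finally show ?thesis
    unfolding weighted_energy_eq[OF \<mu> w H1_D(3)[OF h]] .
qed

end

text \<open>A negative constant would make the second moment of the saturating function nonpositive,
  so that function would be null. The sign is needed to multiply the bound \<open>\<epsilon>\<close>
  by the constant.\<close>

lemma saturates_poincare_constant_nonneg:
  assumes \<mu>: "\<mu> \<in> measures_P a b" and w: "w \<in> weights a b" and g: "saturates_poincare a b \<mu> w g"
  shows "0 \<le> poincare_constant a b \<mu> w"
proof (rule ccontr)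
  assume "\<not> ?thesis"
  have gH: "g \<in> H1 a b \<mu> w" using g unfolding saturates_poincare_def by blast
  have "0 \<le> (\<integral>x. w x * (weak_deriv a b g x)\<^sup>2 \<partial>\<mu>)"
    unfolding weighted_energy_eq[OF \<mu> w H1_D(3)[OF gH]] by simp
  with \<open>\<not> ?thesis\<close> have "(\<integral>x. (g x)\<^sup>2 \<partial>\<mu>) \<le> 0"
    using g unfolding saturates_poincare_def by (simp add: mult_nonpos_nonneg)
  then have "(\<integral>x. (g x)\<^sup>2 \<partial>\<mu>) = 0" by (simp add: order_antisym)
  then have "AE x in \<mu>. (g x)\<^sup>2 = 0"
    using L2_integrable_square[OF H1_D(1)[OF gH]] by (subst (asm) integral_nonneg_eq_0_iff_AE) auto
  then show False using g unfolding saturates_poincare_def by simp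
qed

theorem proposition4p2:
  fixes M :: "'a measure" and X :: "'a \<Rightarrow> real ^ 'n::finite" and i :: 'n
    and f D :: "real ^ 'n \<Rightarrow> real" and a b :: ereal and \<mu> :: "real measure"
    and w g :: "real \<Rightarrow> real" and u v :: "('n \<Rightarrow> real) \<Rightarrow> real" and C :: real
  assumes "prob_space M"
    and indep: "prob_space.indep_vars M (\<lambda>_. borel) (\<lambda>j \<omega>. X \<omega> $ j) UNIV"
    and f_meas: "f \<in> borel_measurable borel"
    and f_L2: "(\<lambda>\<omega>. f (X \<omega>)) \<in> L2 M"
    and f_var: "prob_space.variance M (\<lambda>\<omega>. f (X \<omega>)) > 0"
    and ab: "a < b"
    and \<mu>_def: "\<mu> = distr M borel (\<lambda>\<omega>. X \<omega> $ i)"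
    and \<mu>_P: "\<mu> \<in> measures_P a b"
    and w: "w \<in> weights a b"
    and C_def: "C = poincare_constant a b \<mu> w"
    and poincare: "poincare_inequality a b \<mu> w C"
    and D: "is_weak_partial M X i a b f D"
    and D_L2: "(\<lambda>\<omega>. sqrt (w (X \<omega> $ i)) * D (X \<omega>)) \<in> L2 M"
    and u_meas: "u \<in> borel_measurable (omit_space i)"
    and v_meas: "v \<in> borel_measurable (omit_space i)"
    and u_L2: "(\<lambda>\<omega>. u (omit i (X \<omega>))) \<in> L2 M"
    and v_L2: "(\<lambda>\<omega>. v (omit i (X \<omega>))) \<in> L2 M"
    and g: "saturates_poincare a b \<mu> w g"
  shows
    "(\<forall>h \<epsilon>.
        h \<in> H1 a b \<mu> w \<and> centered \<mu> h \<and>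
        (\<forall>x. f x = u (omit i x) + h (x $ i) * v (omit i x)) \<and>
        \<epsilon> \<ge> 0 \<and>
        (\<integral>\<omega>. w (X \<omega> $ i) * (weak_deriv a b h (X \<omega> $ i) - weak_deriv a b g (X \<omega> $ i))\<^sup>2 \<partial>M) \<le> \<epsilon>
        \<longrightarrow>
        0 \<le> C * (weighted_dgsm M X i w D / prob_space.variance M (\<lambda>\<omega>. f (X \<omega>)))
              - total_sobol M X i f \<and>
        C * (weighted_dgsm M X i w D / prob_space.variance M (\<lambda>\<omega>. f (X \<omega>)))
              - total_sobol M X i f
          \<le> C * ((\<integral>\<omega>. (v (omit i (X \<omega>)))\<^sup>2 \<partial>M) / prob_space.variance M (\<lambda>\<omega>. f (X \<omega>))) * \<epsilon>) \<and>
     ((\<forall>x. f x = u (omit i x) + g (x $ i) * v (omit i x)) \<longrightarrow>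
        total_sobol M X i f
          = C * (weighted_dgsm M X i w D / prob_space.variance M (\<lambda>\<omega>. f (X \<omega>))))"
proof -
  interpret indep_coordinates M X
    using assms(1) indep by (intro indep_coordinates.intro indep_coordinates_axioms.intro)
  let ?V = "variance (\<lambda>\<omega>. f (X \<omega>))" and ?c = "expectation (\<lambda>\<omega>. (v (omit i (X \<omega>)))\<^sup>2)"
  have [measurable]: "w \<in> borel_measurable borel" using w by (simp add: weights_def)
  have C0: "0 \<le> C" unfolding C_def by (rule saturates_poincare_constant_nonneg[OF \<mu>_P w g])
  have gH: "g \<in> H1 a b \<mu> w" and gc: "centered \<mu> g"
    and gs: "(\<integral>x. (g x)\<^sup>2 \<partial>\<mu>) = C * (\<integral>x. w x * (weak_deriv a b g x)\<^sup>2 \<partial>\<mu>)"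
    using g unfolding saturates_poincare_def C_def by auto
  have gap: "0 \<le> C * (weighted_dgsm M X i w D / ?V) - total_sobol M X i f \<and>
      C * (weighted_dgsm M X i w D / ?V) - total_sobol M X i f \<le> C * (?c / ?V) * \<epsilon>"
    if h: "h \<in> H1 a b \<mu> w" "centered \<mu> h"
      and f: "\<And>x. f x = u (omit i x) + h (x $ i) * v (omit i x)"
      and \<epsilon>: "(\<integral>\<omega>. w (X \<omega> $ i) * (weak_deriv a b h (X \<omega> $ i) - weak_deriv a b g (X \<omega> $ i))\<^sup>2 \<partial>M) \<le> \<epsilon>"
    for h \<epsilon>
  proof -
    note [measurable] = H1_D(3)[OF gH] H1_D(3)[OF h(1)]
    have hm[measurable]: "h \<in> borel_measurable borel"
      using L2_measurable[OF H1_D(1)[OF h(1)]] measures_P_D(2)[OF \<mu>_P] by (simp cong: measurable_cong_sets)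
    let ?A = "\<integral>x. (h x)\<^sup>2 \<partial>\<mu>" and ?E = "\<integral>x. w x * (weak_deriv a b h x)\<^sup>2 \<partial>\<mu>"
    have h_L2: "(\<lambda>\<omega>. h (X \<omega> $ i)) \<in> L2 M"
      using L2_integrable_square[OF H1_D(1)[OF h(1)]] integrable_distr[OF coord_measurable]
      unfolding L2_def \<mu>_def by auto
    have h0: "expectation (\<lambda>\<omega>. h (X \<omega> $ i)) = 0"
      using h(2) unfolding centered_def \<mu>_def by (subst (asm) integral_distr) auto
    have "expectation (\<lambda>\<omega>. (h (X \<omega> $ i))\<^sup>2) = ?A"
      unfolding \<mu>_def by (subst integral_distr) auto
    then have sobol: "total_sobol M X i f = ?A * ?c / ?V"
      unfolding total_sobol_def
        variance_total_effect_separated[OF f u_meas v_meas hm u_L2 v_L2 h_L2 h0] by simp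
    have dgsm: "weighted_dgsm M X i w D = ?E * ?c"
      by (rule weighted_dgsm_separated[OF \<mu>_def \<mu>_P w D f v_meas v_L2 h(1)])
    \<comment> \<open>The omitted coordinates enter both indices through the common factor
      \<open>?c / ?V\<close>, so everything reduces to the one-dimensional deficit.\<close>
    have eq: "C * (weighted_dgsm M X i w D / ?V) - total_sobol M X i f = (C * ?E - ?A) * (?c / ?V)"
      unfolding sobol dgsm by (simp add: algebra_simps diff_divide_distrib)
    note bounds = poincare_deficit_bounds[OF \<mu>_P w poincare gH gc gs h]
    have "(\<integral>x. w x * (weak_deriv a b h x - weak_deriv a b g x)\<^sup>2 \<partial>\<mu>) \<le> \<epsilon>"
      using \<epsilon> unfolding \<mu>_def by (subst integral_distr) auto
    with bounds(2) have "C * ?E - ?A \<le> C * \<epsilon>"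
      using mult_left_mono[OF _ C0] by (meson order_trans)
    moreover have "0 \<le> ?c / ?V" using f_var by simp
    ultimately have "(C * ?E - ?A) * (?c / ?V) \<le> C * \<epsilon> * (?c / ?V)"
      by (rule mult_right_mono)
    moreover have "0 \<le> (C * ?E - ?A) * (?c / ?V)"
      using bounds(1) \<open>0 \<le> ?c / ?V\<close> by (intro mult_nonneg_nonneg) simp_all
    ultimately show ?thesis
      unfolding eq by (simp only: mult_ac simp_thms)
  qed
  show ?thesis
  proof (intro conjI allI impI)
    fix h \<epsilon>
    assume *: "h \<in> H1 a b \<mu> w \<and> centered \<mu> h \<and>
      (\<forall>x. f x = u (omit i x) + h (x $ i) * v (omit i x)) \<and> \<epsilon> \<ge> 0 \<and>
      (\<integral>\<omega>. w (X \<omega> $ i) * (weak_deriv a b h (X \<omega> $ i) - weak_deriv a b g (X \<omega> $ i))\<^sup>2 \<partial>M) \<le> \<epsilon>"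
    then show "0 \<le> C * (weighted_dgsm M X i w D / ?V) - total_sobol M X i f"
      and "C * (weighted_dgsm M X i w D / ?V) - total_sobol M X i f \<le> C * (?c / ?V) * \<epsilon>"
      using gap[of h \<epsilon>] by blast+
  next
    assume "\<forall>x. f x = u (omit i x) + g (x $ i) * v (omit i x)"
    \<comment> \<open>With \<open>h = g\<close> the energy of the difference is zero, so
      \<open>\<epsilon> = 0\<close> is admissible and the two bounds coincide.\<close>
    then show "total_sobol M X i f = C * (weighted_dgsm M X i w D / ?V)"
      using gap[OF gH gc, of 0] by simp
  qed
qed

end
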